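(* Let $A,B,C$ be convex bodies in $\mathbb{R}^n$. Then $$|A|\,|A+B+C|\le\frac{1}{2^n}\binom{2n}{n}c_n\min\{|A-B|\,|A+C|,\ |A-B|\,|A-C|\}.$$
   Context: $|\cdot|$ is $n$-dimensional volume, $A+B$ and $A-B=\{a-b:a\in A,b\in B\}$ are Minkowski sum and difference. A convex body is a compact convex set with nonempty interior. $c_n$ denotes the infimum of all constants $c>0$ such that $|A|\,|A+B+C|\le c\,|A+B|\,|A+C|$ holds for all compact convex sets $A,B,C$ in $\mathbb{R}^n$. *)

theory Defs
  imports "HOL-Analysis.Analysis"
begin

definition msum :: "'a::ab_group_add set \<Rightarrow> 'a set \<Rightarrow> 'a set" where
  "msum A B = {a + b | a b. a \<in> A \<and> b \<in> B}"

definition mdiff :: "'a::ab_group_add set \<Rightarrow> 'a set \<Rightarrow> 'a set" where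
  "mdiff A B = {a - b | a b. a \<in> A \<and> b \<in> B}"

abbreviation vol :: "'a::euclidean_space set \<Rightarrow> real" where
  "vol S \<equiv> measure lebesgue S"

definition convex_body :: "'a::euclidean_space set \<Rightarrow> bool" where
  "convex_body K \<longleftrightarrow> compact K \<and> convex K \<and> interior K \<noteq> {}"

definition c_const :: "'a::euclidean_space itself \<Rightarrow> real" where
  "c_const _ = Inf {c. c > 0 \<and> (\<forall>A B C :: 'a set.
      compact A \<and> convex A \<and> compact B \<and> convex B \<and> compact C \<and> convex C \<longrightarrow>
      vol A * vol (msum (msum A B) C) \<le> c * vol (msum A B) * vol (msum A C))}"

end

theory Submission
  imports Defs
begin

text \<open>By Rogers--Shephard for \<open>A - B\<close> and \<open>|K - K| \<ge> 2\<^sup>n |K|\<close> for \<open>K = A + B\<close>, the identity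
  \<open>(A - B) - (A - B) = (A + B) - (A + B)\<close> gives \<open>|A + B| \<le> 2\<^sup>-\<^sup>n (2n choose n) |A - B|\<close>. The first bound is this
  estimate after the inequality defining \<open>c\<^sub>n\<close>; for the second one, replace \<open>A + (B + C)\<close> by \<open>A - (B + C)\<close> and apply the
  inequality to \<open>-A, B, C\<close>. In both cases one needs that \<open>c\<^sub>n\<close> is the infimum of a nonempty
  set of constants, and Ruzsa's triangle inequality provides one.\<close>

section \<open>Minkowski sums and differences: algebra, compactness, convexity, volume\<close>

lemma mdiff_eq_msum_uminus: "mdiff S T = msum S (uminus ` T)"
  unfolding mdiff_def msum_def by force

lemma msum_commute: "msum S T = msum T S"
  unfolding msum_def by (metis add.commute)

lemma msum_assoc: "msum (msum S T) U = msum S (msum T U)"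
  unfolding msum_def by (simp, metis (no_types, opaque_lifting) add.assoc)

lemma uminus_image_uminus_image [simp]: "uminus ` uminus ` (S :: 'a::group_add set) = S"
  by (simp add: image_image)

lemma uminus_image_msum: "uminus ` msum S T = msum (uminus ` S) (uminus ` T)"
  for S T :: "'a::ab_group_add set"
proof -
  have "msum P Q = (\<lambda>(a, b). a + b) ` (P \<times> Q)" for P Q :: "'a set"
    unfolding msum_def by auto
  then show ?thesis
    by (force simp: image_iff)
qed

lemma compact_uminus_image:
  fixes S :: "'a::real_normed_vector set"
  shows "compact S \<Longrightarrow> compact (uminus ` S)"
  by (intro compact_continuous_image continuous_intros)

lemma compact_msum:
  fixes S :: "'a::real_normed_vector set"
  shows "compact S \<Longrightarrow> compact T \<Longrightarrow> compact (msum S T)"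
  unfolding msum_def by (rule compact_sums)

lemma compact_mdiff:
  fixes S :: "'a::real_normed_vector set"
  shows "compact S \<Longrightarrow> compact T \<Longrightarrow> compact (mdiff S T)"
  unfolding mdiff_def by (rule compact_differences)

lemma convex_uminus_image:
  fixes S :: "'a::real_vector set"
  shows "convex S \<Longrightarrow> convex (uminus ` S)"
  using convex_negations by auto

lemma convex_msum:
  assumes "convex S" "convex T"
  shows "convex (msum S T)"
proof -
  have "msum S T = (\<Union>x\<in>S. \<Union>y\<in>T. {x + y})"
    unfolding msum_def by auto
  then show ?thesis
    using convex_sums[OF assms] by simp
qed

lemma convex_mdiff:
  assumes "convex S" "convex T"
  shows "convex (mdiff S T)"
  unfolding mdiff_eq_msum_uminus using assms by (intro convex_msum convex_uminus_image)

text \<open>The bridge between the two measures in play: Tonelli arguments run in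
  \<open>lborel\<close>, while \<open>vol\<close> is Lebesgue measure. Compact sets are Borel and of
  finite measure.\<close>

lemma emeasure_lborel_compact:
  fixes S :: "'a::euclidean_space set"
  assumes "compact S"
  shows "emeasure lborel S = ennreal (vol S)"
proof -
  have "S \<in> sets lborel"
    using assms borel_compact by auto
  moreover have "emeasure lborel S < \<infinity>"
    using assms by (rule emeasure_compact_finite)
  ultimately show ?thesis
    by (simp add: emeasure_eq_ennreal_measure)
qed

text \<open>As a simp rule it would rewrite \<open>vol\<close> of Borel sets to
  \<open>measure lborel\<close>, and facts stated with \<open>vol\<close> would no longer
  match.\<close>

declare measure_completion [simp del]

lemma vol_mono_compact:
  fixes S T :: "'a::euclidean_space set"
  assumes "S \<subseteq> T" "compact S" "compact T"
  shows "vol S \<le> vol T"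
  using assms by (intro measure_mono_fmeasurable) (auto intro: lmeasurable_compact fmeasurableD)

lemma vol_scale: "vol ((\<lambda>x. m *\<^sub>R x) ` S) = \<bar>m\<bar> ^ DIM('a) * vol S"
  for S :: "'a::euclidean_space set"
  using measure_lebesgue_affine[of m 0 S] by simp

lemma vol_translate: "vol ((+) a ` S) = vol S"
  for S :: "'a::euclidean_space set"
  using measure_lebesgue_affine[of 1 a S] by (simp add: add.commute)

lemma vol_uminus [simp]: "vol (uminus ` S) = vol S"
  for S :: "'a::euclidean_space set"
  using vol_scale[of "-1" S] by simp

lemma vol_le_vol_msum:
  fixes S T :: "'a::euclidean_space set"
  assumes "compact S" "compact T" "T \<noteq> {}"
  shows "vol S \<le> vol (msum S T)"
proof -
  obtain t where "t \<in> T"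
    using assms by auto
  then have "(+) t ` S \<subseteq> msum S T"
    unfolding msum_def by (force simp: add.commute)
  then have "vol ((+) t ` S) \<le> vol (msum S T)"
    using assms by (intro vol_mono_compact compact_msum compact_translation)
  then show ?thesis
    by (simp add: vol_translate)
qed

subsection \<open>Ruzsa's triangle inequality\<close>

lemma nn_integral_lborel_translate:
  fixes f :: "'a::euclidean_space \<Rightarrow> ennreal"
  assumes [measurable]: "f \<in> borel_measurable borel"
  shows "(\<integral>\<^sup>+x. f (a + x) \<partial>lborel) = (\<integral>\<^sup>+x. f x \<partial>lborel)"
  by (subst lborel_distr_plus[of a, symmetric]) (simp add: nn_integral_distr)

text \<open>The integrand is the convolution of the indicators of \<open>S\<close> and
  \<open>T\<close>, so its total mass factorizes. For T = -D the fibre is the overlap of D with x +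
  D.\<close>

lemma nn_integral_overlap:
  fixes S T :: "'a::euclidean_space set"
  assumes "compact S" "compact T"
  shows "(\<integral>\<^sup>+x. emeasure lborel {y \<in> S. x - y \<in> T} \<partial>lborel) = ennreal (vol S * vol T)"
proof -
  have [measurable]: "S \<in> sets borel" "T \<in> sets borel"
    using assms by (auto intro: borel_compact)
  have "(\<integral>\<^sup>+x. emeasure lborel {y \<in> S. x - y \<in> T} \<partial>lborel)
      = (\<integral>\<^sup>+x. \<integral>\<^sup>+y. indicator S y * indicator T (x - y) \<partial>lborel \<partial>lborel)"
  proof (intro nn_integral_cong)
    fix x :: 'a
    have "{y \<in> S. x - y \<in> T} \<in> sets lborel"
      by measurable
    then have "emeasure lborel {y \<in> S. x - y \<in> T} = (\<integral>\<^sup>+y. indicator {y \<in> S. x - y \<in> T} y \<partial>lborel)"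
      by simp
    also have "\<dots> = (\<integral>\<^sup>+y. indicator S y * indicator T (x - y) \<partial>lborel)"
      by (intro nn_integral_cong) (auto simp: indicator_def)
    finally show "emeasure lborel {y \<in> S. x - y \<in> T} = \<dots>" .
  qed
  also have "\<dots> = (\<integral>\<^sup>+y. \<integral>\<^sup>+x. indicator S y * indicator T (x - y) \<partial>lborel \<partial>lborel)"
    by (rule lborel_pair.Fubini') measurable
  also have "\<dots> = (\<integral>\<^sup>+y. indicator S y * (\<integral>\<^sup>+x. indicator T (-y + x) \<partial>lborel) \<partial>lborel)"
    by (intro nn_integral_cong) (simp add: nn_integral_cmult)
  also have "\<dots> = (\<integral>\<^sup>+y. indicator S y * emeasure lborel T \<partial>lborel)"
    by (subst nn_integral_lborel_translate) auto
  also have "\<dots> = emeasure lborel S * emeasure lborel T"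
    by (simp add: nn_integral_multc)
  finally show ?thesis
    using assms by (simp add: emeasure_lborel_compact ennreal_mult')
qed

text \<open>For \<open>x = s + c\<close> with \<open>s \<in> S\<close>, \<open>c \<in> T\<close>, the fibre \<open>{y \<in> A + S. x - y \<in> T - A}\<close> contains
  the translate \<open>s + A\<close>.\<close>

lemma vol_ruzsa_triangle:
  fixes A S T :: "'a::euclidean_space set"
  assumes "compact A" "compact S" "compact T"
  shows "vol A * vol (msum S T) \<le> vol (msum A S) * vol (mdiff T A)"
proof -
  let ?F = "\<lambda>x. {y \<in> msum A S. x - y \<in> mdiff T A}"
  have F: "?F x \<in> sets lborel" for x
  proof -
    have [measurable]: "msum A S \<in> sets borel" "mdiff T A \<in> sets borel"
      using assms by (auto intro!: borel_compact compact_msum compact_mdiff)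
    show ?thesis
      by measurable
  qed
  have "ennreal (vol A) * indicator (msum S T) x \<le> emeasure lborel (?F x)" for x
  proof (cases "x \<in> msum S T")
    case True
    then obtain s c where x: "x = s + c" "s \<in> S" "c \<in> T"
      unfolding msum_def by auto
    have "(+) s ` A \<subseteq> ?F x"
      using x unfolding msum_def mdiff_def by (force simp: algebra_simps)
    then have "emeasure lborel ((+) s ` A) \<le> emeasure lborel (?F x)"
      by (rule emeasure_mono[OF _ F])
    moreover have "emeasure lborel ((+) s ` A) = ennreal (vol A)"
      using assms by (simp add: emeasure_lborel_compact compact_translation vol_translate)
    ultimately show ?thesis
      using True by simp
  qed simp
  then have "(\<integral>\<^sup>+x. ennreal (vol A) * indicator (msum S T) x \<partial>lborel)
      \<le> (\<integral>\<^sup>+x. emeasure lborel (?F x) \<partial>lborel)"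
    by (intro nn_integral_mono)
  also have "\<dots> = ennreal (vol (msum A S) * vol (mdiff T A))"
    using assms by (intro nn_integral_overlap compact_msum compact_mdiff)
  also have "(\<integral>\<^sup>+x. ennreal (vol A) * indicator (msum S T) x \<partial>lborel)
      = ennreal (vol A * vol (msum S T))"
  proof -
    have c: "compact (msum S T)"
      using assms by (intro compact_msum)
    then have "msum S T \<in> sets lborel"
      by (auto intro: borel_compact)
    then show ?thesis
      using c by (simp add: nn_integral_cmult emeasure_lborel_compact ennreal_mult')
  qed
  finally show ?thesis
    by simp
qed

subsection \<open>The Rogers--Shephard inequality\<close>

text \<open>The value is n B(n, n + 1) = n! n! / (2n)!; the binomial coefficient of Rogers-Shephard
  arises here.\<close>

lemma nn_integral_beta_central:
  assumes "n > 0"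
  shows "(\<integral>\<^sup>+t. ennreal (real n * t ^ (n - 1) * (1 - t) ^ n) * indicator {0..1} t \<partial>lborel)
    = ennreal (1 / real (2 * n choose n))"
proof -
  have "((\<lambda>t. t powr (real n - 1) * (1 - t) powr (real (Suc n) - 1)) has_integral
      Beta (real n) (real (Suc n))) {0..1}"
    using assms by (intro has_integral_Beta_real) auto
  \<comment> \<open>The passage from \<open>powr\<close> to \<open>^\<close> is made on the open
    interval: at t = 0 with n = 1, \<open>0 powr 0 = 0\<close> but \<open>0 ^ 0 = 1\<close>.\<close>
  then have "((\<lambda>t. t ^ (n - 1) * (1 - t) ^ n) has_integral Beta (real n) (real (Suc n))) {0<..<1}"
    unfolding has_integral_Icc_iff_Ioo
    by (rule has_integral_eq[rotated]) (use assms in \<open>auto simp: powr_realpow[symmetric] of_nat_diff\<close>)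
  then have "((\<lambda>t. t ^ (n - 1) * (1 - t) ^ n) has_integral Beta (real n) (real (Suc n))) {0..1}"
    by (simp add: has_integral_Icc_iff_Ioo)
  from has_integral_mult_right[OF this, of "real n"]
  have "((\<lambda>t. real n * t ^ (n - 1) * (1 - t) ^ n) has_integral real n * Beta (real n) (real (Suc n))) {0..1}"
    by (simp add: mult_ac)
  then have "(\<integral>\<^sup>+t. ennreal (real n * t ^ (n - 1) * (1 - t) ^ n) * indicator {0..1} t \<partial>lborel)
      = ennreal (real n * Beta (real n) (real (Suc n)))"
    by (intro nn_integral_has_integral_lebesgue') auto
  also have "real n * Beta (real n) (real (Suc n)) = 1 / real (2 * n choose n)"
  proof -
    obtain m where m: "n = Suc m"
      using assms by (cases n) auto
    have "Gamma (real n) = fact m"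
      using Gamma_fact[of m, where 'a = real] m by (simp add: add.commute)
    moreover have "Gamma (real (Suc n)) = fact n"
      using Gamma_fact[of n, where 'a = real] by (simp add: add.commute)
    moreover have "Gamma (real n + real (Suc n)) = fact (2 * n)"
      using Gamma_fact[of "2 * n", where 'a = real] by (simp add: algebra_simps)
    moreover have "real (2 * n choose n) = fact (2 * n) / (fact n * fact n)"
      by (simp add: binomial_fact)
    ultimately show ?thesis
      unfolding Beta_def using m by simp
  qed
  finally show ?thesis .
qed

text \<open>If \<open>x = (1 - t) (d - d')\<close> with \<open>d, d' \<in> D\<close>, then \<open>t D + (1 - t) d\<close> lies in \<open>D \<inter> (x + D)\<close>.\<close>

lemma vol_overlap_ge:
  fixes D :: "'a::euclidean_space set"
  assumes D: "compact D" "convex D" and t: "0 \<le> t" "t \<le> 1"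
    and x: "x \<in> (\<lambda>y. (1 - t) *\<^sub>R y) ` mdiff D D"
  shows "t ^ DIM('a) * vol D \<le> vol {y \<in> D. x - y \<in> uminus ` D}"
proof -
  have E: "{y \<in> D. x - y \<in> uminus ` D} = D \<inter> (+) x ` D"
    by (force simp: image_iff algebra_simps)
  obtain d d' where d: "d \<in> D" "d' \<in> D" "x = (1 - t) *\<^sub>R (d - d')"
    using x unfolding mdiff_def by auto
  have "(\<lambda>y. t *\<^sub>R y + (1 - t) *\<^sub>R d) ` D \<subseteq> D \<inter> (+) x ` D"
  proof
    fix z assume "z \<in> (\<lambda>y. t *\<^sub>R y + (1 - t) *\<^sub>R d) ` D"
    then obtain y where y: "y \<in> D" "z = t *\<^sub>R y + (1 - t) *\<^sub>R d"
      by auto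
    have "z = x + (t *\<^sub>R y + (1 - t) *\<^sub>R d')"
      unfolding y(2) d(3) by (simp add: algebra_simps)
    moreover have "t *\<^sub>R y + (1 - t) *\<^sub>R d \<in> D" "t *\<^sub>R y + (1 - t) *\<^sub>R d' \<in> D"
      using y d t D(2) by (auto intro!: convexD)
    ultimately show "z \<in> D \<inter> (+) x ` D"
      using y(2) by (metis IntI image_eqI)
  qed
  moreover have "compact ((\<lambda>y. t *\<^sub>R y + (1 - t) *\<^sub>R d) ` D)"
    using D by (intro compact_continuous_image continuous_intros)
  moreover have "compact (D \<inter> (+) x ` D)"
    using D by (intro compact_Int compact_translation)
  ultimately have "vol ((\<lambda>y. t *\<^sub>R y + (1 - t) *\<^sub>R d) ` D) \<le> vol (D \<inter> (+) x ` D)"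
    by (rule vol_mono_compact)
  moreover have "vol ((\<lambda>y. t *\<^sub>R y + (1 - t) *\<^sub>R d) ` D) = t ^ DIM('a) * vol D"
    using measure_lebesgue_affine[of t "(1 - t) *\<^sub>R d" D] t by simp
  ultimately show ?thesis
    unfolding E by simp
qed

text \<open>The overlap function g(x) = |D \<inter> (x + D)| has integral |D|^2, and
  \<open>vol_overlap_ge\<close> bounds it below by t^n |D| on (1 - t)(D - D). Integrating over these
  layers with weight n t^(n-1) gives |D| |D - D| times the integral of
  \<open>nn_integral_beta_central\<close> as a lower bound.\<close>

theorem rogers_shephard:
  fixes D :: "'a::euclidean_space set"
  assumes D: "compact D" "convex D" and pos: "vol D > 0"
  shows "vol (mdiff D D) \<le> real (2 * DIM('a) choose DIM('a)) * vol D"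
proof -
  let ?n = "DIM('a)"
  let ?E = "\<lambda>x. {y \<in> D. x - y \<in> uminus ` D}"
  \<comment> \<open>\<open>?w\<close> is the derivative of t^n on [0, 1]. \<open>?G\<close> collects
    the layers (1 - t)(D - D) into one compact set, which makes \<open>?h\<close> jointly
    measurable.\<close>
  let ?w = "\<lambda>t::real. ennreal (real ?n * t ^ (?n - 1)) * indicator {0..1} t"
  let ?G = "(\<lambda>(t, d). (t, (1 - t) *\<^sub>R d)) ` ({0..1::real} \<times> mdiff D D)"
  let ?h = "\<lambda>t x. ?w t * indicator ?G (t, x)"
  have cD2: "compact (mdiff D D)"
    using D by (intro compact_mdiff)
  have "compact ?G"
    unfolding case_prod_beta
    by (intro compact_continuous_image continuous_intros compact_Times cD2) auto
  then have [measurable]: "?G \<in> sets borel"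
    by (rule borel_compact)
  have [measurable]: "?G \<in> sets (lborel \<Otimes>\<^sub>M lborel)"
    unfolding lborel_prod sets_lborel by fact
  have G: "(t, x) \<in> ?G \<longleftrightarrow> t \<in> {0..1} \<and> x \<in> (\<lambda>y. (1 - t) *\<^sub>R y) ` mdiff D D" for t x
    by auto
  have layer: "ennreal (vol D) * (\<integral>\<^sup>+t. ?h t x \<partial>lborel) \<le> emeasure lborel (?E x)" for x
  proof -
    have E: "?E x = D \<inter> (+) x ` D"
      by (force simp: image_iff algebra_simps)
    have cE: "compact (?E x)"
      unfolding E using D by (intro compact_Int compact_translation)
    \<comment> \<open>By \<open>vol_overlap_ge\<close>, every t whose layer contains x satisfies t
      \<le> s; the weight integrates over [0, s] to s^n, the relative overlap.\<close>
    define s where "s = root ?n (vol (?E x) / vol D)"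
    have s: "0 \<le> s" "s ^ ?n = vol (?E x) / vol D"
      using pos by (auto simp: s_def)
    have "?h t x \<le> ennreal (real ?n * t ^ (?n - 1)) * indicator {0..s} t" for t
    proof (cases "(t, x) \<in> ?G")
      case True
      then have t: "0 \<le> t" "t \<le> 1" "x \<in> (\<lambda>y. (1 - t) *\<^sub>R y) ` mdiff D D"
        unfolding G by auto
      have "t ^ ?n \<le> s ^ ?n"
      proof (rule mult_right_le_imp_le)
        show "t ^ ?n * vol D \<le> s ^ ?n * vol D"
          using vol_overlap_ge[OF D t] pos s by simp
      qed (rule pos)
      then have "t \<le> s"
        using s by (meson DIM_positive power_mono_iff t(1))
      then show ?thesis
        using t by (auto simp: indicator_def)
    qed auto
    then have "(\<integral>\<^sup>+t. ?h t x \<partial>lborel) \<le> (\<integral>\<^sup>+t. ennreal (real ?n * t ^ (?n - 1)) * indicator {0..s} t \<partial>lborel)"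
      by (intro nn_integral_mono)
    also have "\<dots> = ennreal (s ^ ?n - 0 ^ ?n)"
      using s(1) by (intro nn_integral_FTC_Icc) (auto intro!: derivative_eq_intros)
    also have "\<dots> = ennreal (vol (?E x) / vol D)"
      using s by (simp add: power_0_left)
    finally have "ennreal (vol D) * (\<integral>\<^sup>+t. ?h t x \<partial>lborel) \<le> ennreal (vol D) * ennreal (vol (?E x) / vol D)"
      by (intro mult_left_mono) auto
    also have "\<dots> = ennreal (vol (?E x))"
      using pos by (simp add: ennreal_mult'[symmetric])
    finally show ?thesis
      using cE by (simp add: emeasure_lborel_compact)
  qed
  have "ennreal (vol D) * (\<integral>\<^sup>+x. \<integral>\<^sup>+t. ?h t x \<partial>lborel \<partial>lborel)
      = (\<integral>\<^sup>+x. ennreal (vol D) * (\<integral>\<^sup>+t. ?h t x \<partial>lborel) \<partial>lborel)"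
    by (subst nn_integral_cmult) auto
  also have "\<dots> \<le> (\<integral>\<^sup>+x. emeasure lborel (?E x) \<partial>lborel)"
    by (intro nn_integral_mono layer)
  also have "\<dots> = ennreal (vol D * vol (uminus ` D))"
    using D by (intro nn_integral_overlap compact_uminus_image)
  \<comment> \<open>After the exchange, the section of \<open>?G\<close> at fixed t is (1 - t)(D -
    D), of volume (1 - t)^n |D - D|; a Beta integral in t remains.\<close>
  also have "(\<integral>\<^sup>+x. \<integral>\<^sup>+t. ?h t x \<partial>lborel \<partial>lborel) = (\<integral>\<^sup>+t. \<integral>\<^sup>+x. ?h t x \<partial>lborel \<partial>lborel)"
    by (rule lborel_pair.Fubini') measurable
  also have "\<dots> = (\<integral>\<^sup>+t. ennreal (vol (mdiff D D)) *
      (ennreal (real ?n * t ^ (?n - 1) * (1 - t) ^ ?n) * indicator {0..1} t) \<partial>lborel)"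
  proof (intro nn_integral_cong)
    fix t :: real
    show "(\<integral>\<^sup>+x. ?h t x \<partial>lborel) = ennreal (vol (mdiff D D)) *
      (ennreal (real ?n * t ^ (?n - 1) * (1 - t) ^ ?n) * indicator {0..1} t)"
    proof (cases "t \<in> {0..1}")
      case True
      let ?S = "(\<lambda>y. (1 - t) *\<^sub>R y) ` mdiff D D"
      have c: "compact ?S"
        by (intro compact_scaling cD2)
      have [measurable]: "?S \<in> sets borel"
        using c by (rule borel_compact)
      have "(\<integral>\<^sup>+x. ?h t x \<partial>lborel) = (\<integral>\<^sup>+x. ennreal (real ?n * t ^ (?n - 1)) * indicator ?S x \<partial>lborel)"
        using True by (intro nn_integral_cong) (auto simp: indicator_def G simp del: Pair_inject)
      also have "\<dots> = ennreal (real ?n * t ^ (?n - 1)) * ennreal ((1 - t) ^ ?n * vol (mdiff D D))"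
        using c True vol_scale[of "1 - t" "mdiff D D"]
        by (simp add: nn_integral_cmult emeasure_lborel_compact)
      finally show ?thesis
        using True by (simp add: ennreal_mult'[symmetric] mult_ac)
    qed simp
  qed
  also have "\<dots> = ennreal (vol (mdiff D D)) * ennreal (1 / real (2 * ?n choose ?n))"
    by (subst nn_integral_cmult) (use nn_integral_beta_central[of ?n] in auto)
  finally have "ennreal (vol D * (vol (mdiff D D) / real (2 * ?n choose ?n))) \<le> ennreal (vol D * vol D)"
    by (simp add: ennreal_mult'[symmetric])
  then have "vol D * (vol (mdiff D D) / real (2 * ?n choose ?n)) \<le> vol D * vol D"
    by simp
  then have "vol (mdiff D D) / real (2 * ?n choose ?n) \<le> vol D"
    using pos by (rule mult_left_le_imp_le)
  then show ?thesis
    by (simp add: field_simps)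
qed

subsection \<open>Steiner symmetrization\<close>

text \<open>Integrating \<open>indicator S (x + t e)\<close> over the slab \<open>0 \<le> x \<bullet> e \<le> 1\<close> and over all \<open>t\<close> expresses the volume
  through the chords in direction \<open>e\<close> without splitting the space as a product.\<close>

lemma emeasure_eq_nn_integral_chords:
  fixes S :: "'a::euclidean_space set"
  assumes [measurable]: "S \<in> sets borel" and e: "norm e = 1"
  shows "emeasure lborel S
    = (\<integral>\<^sup>+x. indicator {0..1} (x \<bullet> e) * emeasure lborel {t. x + t *\<^sub>R e \<in> S} \<partial>lborel)"
proof -
  have ee: "e \<bullet> e = 1"
    using e by (simp add: dot_square_norm)
  have "(\<integral>\<^sup>+x. indicator {0..1} (x \<bullet> e) * emeasure lborel {t. x + t *\<^sub>R e \<in> S} \<partial>lborel)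
      = (\<integral>\<^sup>+x. \<integral>\<^sup>+t. indicator {0..1} (x \<bullet> e) * indicator S (t *\<^sub>R e + x) \<partial>lborel \<partial>lborel)"
  proof (intro nn_integral_cong)
    fix x :: 'a
    have "{t. x + t *\<^sub>R e \<in> S} \<in> sets lborel"
      by measurable
    then have "emeasure lborel {t. x + t *\<^sub>R e \<in> S} = (\<integral>\<^sup>+t. indicator {t. x + t *\<^sub>R e \<in> S} t \<partial>lborel)"
      by simp
    also have "\<dots> = (\<integral>\<^sup>+t. indicator S (t *\<^sub>R e + x) \<partial>lborel)"
      by (intro nn_integral_cong) (auto simp: indicator_def add.commute)
    finally show "indicator {0..1} (x \<bullet> e) * emeasure lborel {t. x + t *\<^sub>R e \<in> S}
        = (\<integral>\<^sup>+t. indicator {0..1} (x \<bullet> e) * indicator S (t *\<^sub>R e + x) \<partial>lborel)"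
      by (simp add: nn_integral_cmult)
  qed
  also have "\<dots> = (\<integral>\<^sup>+t. \<integral>\<^sup>+x. indicator {0..1} (x \<bullet> e) * indicator S (t *\<^sub>R e + x) \<partial>lborel \<partial>lborel)"
    by (rule lborel_pair.Fubini') measurable
  \<comment> \<open>As e is a unit vector, the slab condition can be expressed through t e + x. The
    translation can then be dropped, and for fixed x the admissible t form an interval of length
    1.\<close>
  also have "\<dots> = (\<integral>\<^sup>+t. \<integral>\<^sup>+x. indicator {0..1} ((t *\<^sub>R e + x) \<bullet> e - t) * indicator S (t *\<^sub>R e + x) \<partial>lborel \<partial>lborel)"
    by (simp add: inner_add_left ee)
  also have "\<dots> = (\<integral>\<^sup>+t. \<integral>\<^sup>+x. indicator {0..1} (x \<bullet> e - t) * indicator S x \<partial>lborel \<partial>lborel)"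
    by (intro nn_integral_cong nn_integral_lborel_translate[where
          f = "\<lambda>x. indicator {0..1} (x \<bullet> e - t) * indicator S x" for t]) measurable
  also have "\<dots> = (\<integral>\<^sup>+x. \<integral>\<^sup>+t. indicator {0..1} (x \<bullet> e - t) * indicator S x \<partial>lborel \<partial>lborel)"
    by (rule lborel_pair.Fubini') measurable
  also have "\<dots> = (\<integral>\<^sup>+x. indicator S x \<partial>lborel)"
  proof (intro nn_integral_cong)
    fix x :: 'a
    have "(\<integral>\<^sup>+t. indicator {0..1} (x \<bullet> e - t) \<partial>lborel) = (\<integral>\<^sup>+t. indicator {x \<bullet> e - 1..x \<bullet> e} t \<partial>lborel)"
      by (intro nn_integral_cong) (auto simp: indicator_def)
    also have "\<dots> = 1"
      by simp
    finally show "(\<integral>\<^sup>+t. indicator {0..1} (x \<bullet> e - t) * indicator S x \<partial>lborel) = indicator S x"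
      by (simp add: nn_integral_multc)
  qed
  finally show ?thesis
    by simp
qed

definition reflect :: "'a::euclidean_space \<Rightarrow> 'a \<Rightarrow> 'a" where
  "reflect e x = x - (2 * (x \<bullet> e)) *\<^sub>R e"

text \<open>Since \<open>x + R x\<close> is twice the projection of \<open>x\<close> to the mirror of the reflection \<open>R\<close>, the points \<open>x\<close> and \<open>y\<close>
  below lie on a common chord; for convex \<open>K\<close> this is the Steiner symmetral.\<close>

definition steiner :: "'a::euclidean_space \<Rightarrow> 'a set \<Rightarrow> 'a set" where
  "steiner e K = {(1/2) *\<^sub>R (x + reflect e y) | x y. x \<in> K \<and> y \<in> K \<and> x + reflect e x = y + reflect e y}"

lemma steinerI:
  assumes "x \<in> K" "y \<in> K" "x + reflect e x = y + reflect e y" "z = (1/2) *\<^sub>R (x + reflect e y)"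
  shows "z \<in> steiner e K"
  unfolding steiner_def using assms by auto

lemma steinerE:
  assumes "z \<in> steiner e K"
  obtains x y where "x \<in> K" "y \<in> K" "x + reflect e x = y + reflect e y" "z = (1/2) *\<^sub>R (x + reflect e y)"
  using assms unfolding steiner_def by auto

lemma linear_reflect: "linear (reflect e)"
  by (rule linearI) (simp_all add: reflect_def inner_add_left algebra_simps)

lemmas reflect_linear_simps =
  linear_add[OF linear_reflect] linear_diff[OF linear_reflect] linear_scale[OF linear_reflect]

lemma reflect_reflect:
  assumes "norm e = 1"
  shows "reflect e (reflect e x) = x"
proof -
  have "e \<bullet> e = 1"
    using assms by (simp add: dot_square_norm)
  then show ?thesis
    by (simp add: reflect_def inner_diff_left algebra_simps)
qed

lemma reflect_commute:
  assumes "e \<bullet> f = 0"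
  shows "reflect e (reflect f x) = reflect f (reflect e x)"
  using assms by (simp add: reflect_def inner_diff_left inner_commute[of f e])

text \<open>Exhibits the symmetral as a continuous image of a closed part of K \<times> K, for
  compactness.\<close>

lemma steiner_eq_image:
  "steiner e K = (\<lambda>(x, y). (1/2) *\<^sub>R (x + reflect e y)) `
     ((K \<times> K) \<inter> {p. fst p + reflect e (fst p) = snd p + reflect e (snd p)})"
  by (simp add: steiner_def set_eq_iff image_iff Bex_def) blast

lemma compact_steiner:
  assumes "compact K"
  shows "compact (steiner e K)"
proof -
  have "closed {p. fst p + reflect e (fst p) = snd p + reflect e (snd p)}"
    unfolding reflect_def by (intro closed_Collect_eq continuous_intros)
  then show ?thesis
    unfolding steiner_eq_image case_prod_beta using assms unfolding reflect_def
    by (intro compact_continuous_image continuous_intros compact_Int_closed compact_Times)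
qed

text \<open>Both the common-chord condition and the midpoint are linear in the pair (x, y), so
  convex combinations of witnesses are witnesses.\<close>

lemma convex_steiner:
  assumes "convex K"
  shows "convex (steiner e K)"
proof (rule convexI)
  fix z z' and u v :: real
  assume z: "z \<in> steiner e K" "z' \<in> steiner e K" and uv: "0 \<le> u" "0 \<le> v" "u + v = 1"
  obtain x y where xy: "x \<in> K" "y \<in> K" "x + reflect e x = y + reflect e y" "z = (1/2) *\<^sub>R (x + reflect e y)"
    using z(1) by (rule steinerE)
  obtain x' y' where xy': "x' \<in> K" "y' \<in> K" "x' + reflect e x' = y' + reflect e y'" "z' = (1/2) *\<^sub>R (x' + reflect e y')"
    using z(2) by (rule steinerE)
  let ?x = "u *\<^sub>R x + v *\<^sub>R x'" and ?y = "u *\<^sub>R y + v *\<^sub>R y'"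
  have "?x \<in> K" "?y \<in> K"
    using assms xy xy' uv by (auto intro: convexD)
  moreover have "?x + reflect e ?x = ?y + reflect e ?y"
  proof -
    have "?x + reflect e ?x = u *\<^sub>R (x + reflect e x) + v *\<^sub>R (x' + reflect e x')"
      by (simp add: reflect_linear_simps algebra_simps)
    also have "\<dots> = u *\<^sub>R (y + reflect e y) + v *\<^sub>R (y' + reflect e y')"
      using xy xy' by simp
    finally show ?thesis
      by (simp add: reflect_linear_simps algebra_simps)
  qed
  moreover have "u *\<^sub>R z + v *\<^sub>R z' = (1/2) *\<^sub>R (?x + reflect e ?y)"
    unfolding xy xy' by (simp add: reflect_linear_simps algebra_simps)
  ultimately show "u *\<^sub>R z + v *\<^sub>R z' \<in> steiner e K"
    by (rule steinerI)
qed

text \<open>The reflection merely exchanges the two witnesses.\<close>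

lemma reflect_mem_steiner:
  assumes "norm e = 1" "z \<in> steiner e K"
  shows "reflect e z \<in> steiner e K"
proof -
  obtain x y where xy: "x \<in> K" "y \<in> K" "x + reflect e x = y + reflect e y" "z = (1/2) *\<^sub>R (x + reflect e y)"
    using assms(2) by (rule steinerE)
  have "reflect e z = (1/2) *\<^sub>R (y + reflect e x)"
    unfolding xy using assms by (simp add: reflect_linear_simps reflect_reflect add.commute)
  then show ?thesis
    using steinerI xy(1-3) by metis
qed

text \<open>Reflections in orthogonal directions commute, so a symmetry already gained survives the
  next symmetrization.\<close>

lemma reflect_mem_steiner_orthogonal:
  assumes "e \<bullet> f = 0" and K: "\<And>x. x \<in> K \<Longrightarrow> reflect f x \<in> K" and "z \<in> steiner e K"
  shows "reflect f z \<in> steiner e K"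
proof -
  obtain x y where xy: "x \<in> K" "y \<in> K" "x + reflect e x = y + reflect e y" "z = (1/2) *\<^sub>R (x + reflect e y)"
    using assms(3) by (rule steinerE)
  have c: "reflect e (reflect f w) = reflect f (reflect e w)" for w
    using assms(1) by (rule reflect_commute)
  have "reflect f z = (1/2) *\<^sub>R (reflect f x + reflect e (reflect f y))"
    unfolding xy c by (simp add: reflect_linear_simps)
  moreover have "reflect f x + reflect e (reflect f x) = reflect f y + reflect e (reflect f y)"
    unfolding c using arg_cong[OF xy(3), of "reflect f"] by (simp add: reflect_linear_simps)
  ultimately show ?thesis
    using K xy(1,2) steinerI by blast
qed

text \<open>By linearity, differences of witness pairs for K are a witness pair for K - K.\<close>

lemma mdiff_steiner_subset: "mdiff (steiner e K) (steiner e K) \<subseteq> steiner e (mdiff K K)"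
proof
  fix w assume "w \<in> mdiff (steiner e K) (steiner e K)"
  then obtain x y x' y' where
    xy: "x \<in> K" "y \<in> K" "x + reflect e x = y + reflect e y" and
    xy': "x' \<in> K" "y' \<in> K" "x' + reflect e x' = y' + reflect e y'" and
    w: "w = (1/2) *\<^sub>R (x + reflect e y) - (1/2) *\<^sub>R (x' + reflect e y')"
    unfolding mdiff_def by (auto elim!: steinerE)
  have "w = (1/2) *\<^sub>R ((x - x') + reflect e (y - y'))"
    unfolding w by (simp add: reflect_linear_simps algebra_simps)
  moreover have "(x - x') + reflect e (x - x') = (y - y') + reflect e (y - y')"
    using arg_cong2[OF xy(3) xy'(3), of "(-)"] by (simp add: reflect_linear_simps algebra_simps)
  moreover have "x - x' \<in> mdiff K K" "y - y' \<in> mdiff K K"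
    using xy xy' unfolding mdiff_def by auto
  ultimately show "w \<in> steiner e (mdiff K K)"
    using steinerI by blast
qed

text \<open>If I is the parameter set of K on the line x + R e, that of the symmetral is (I - I)/2,
  shifted by -(x \<bullet> e) so that it is centred on the mirror.\<close>

lemma steiner_chord:
  fixes e :: "'a::euclidean_space"
  assumes e: "norm e = 1"
  shows "x + t *\<^sub>R e \<in> steiner e K \<longleftrightarrow>
    (\<exists>a b. x + a *\<^sub>R e \<in> K \<and> x + b *\<^sub>R e \<in> K \<and> t = (a - b) / 2 - x \<bullet> e)"
proof -
  have ee: "e \<bullet> e = 1"
    using e by (simp add: dot_square_norm)
  have R: "reflect e (x + b *\<^sub>R e) = x - (2 * (x \<bullet> e) + b) *\<^sub>R e" for b
  proof -
    have "reflect e (x + b *\<^sub>R e) = x + b *\<^sub>R e - ((2 * (x \<bullet> e) + b) + b) *\<^sub>R e"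
      by (simp add: reflect_def inner_add_left ee)
    then show ?thesis
      by (simp only: scaleR_add_left) simp
  qed
  show ?thesis
  proof
    assume "x + t *\<^sub>R e \<in> steiner e K"
    then obtain p q where pq: "p \<in> K" "q \<in> K" "p + reflect e p = q + reflect e q"
      and xt: "x + t *\<^sub>R e = (1/2) *\<^sub>R (p + reflect e q)"
      by (rule steinerE)
    \<comment> \<open>\<open>w\<close> is the common projection of p and q to the mirror, and
      \<open>\<alpha>\<close>, \<open>\<beta>\<close> are their heights over it. Parameters relative
      to x are these heights minus x \<bullet> e.\<close>
    define w \<alpha> \<beta> where "w = p - (p \<bullet> e) *\<^sub>R e" and "\<alpha> = p \<bullet> e" and "\<beta> = q \<bullet> e"
    have we: "w \<bullet> e = 0"
      by (simp add: w_def inner_diff_left ee)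
    have p: "p = w + \<alpha> *\<^sub>R e"
      by (simp add: w_def \<alpha>_def)
    have q: "q = w + \<beta> *\<^sub>R e"
    proof -
      have twice: "y + reflect e y = 2 *\<^sub>R (y - (y \<bullet> e) *\<^sub>R e)" for y
        by (simp add: reflect_def scaleR_diff_right) (simp add: scaleR_2)
      have "w = q - (q \<bullet> e) *\<^sub>R e"
        using pq(3) unfolding twice w_def by simp
      then show ?thesis
        by (simp add: \<beta>_def)
    qed
    have "reflect e q = w - \<beta> *\<^sub>R e"
    proof -
      have "(2 * \<beta>) *\<^sub>R e = \<beta> *\<^sub>R e + \<beta> *\<^sub>R e"
        by (simp flip: scaleR_add_left)
      then show ?thesis
        by (simp add: q reflect_def inner_add_left we ee)
    qed
    then have "p + reflect e q = 2 *\<^sub>R w + (\<alpha> - \<beta>) *\<^sub>R e"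
      by (simp add: p scaleR_2 scaleR_diff_left)
    then have xt': "x + t *\<^sub>R e = w + ((\<alpha> - \<beta>) / 2) *\<^sub>R e"
      unfolding xt by (simp add: scaleR_add_right)
    have t: "x \<bullet> e + t = (\<alpha> - \<beta>) / 2"
      using arg_cong[OF xt', of "\<lambda>z. z \<bullet> e"] by (simp add: inner_add_left we ee)
    have x: "x = w + (x \<bullet> e) *\<^sub>R e"
      using xt' unfolding t[symmetric] scaleR_add_left by (simp add: add.assoc[symmetric])
    have line: "x + (c - x \<bullet> e) *\<^sub>R e = w + c *\<^sub>R e" for c
    proof -
      have "x + (c - x \<bullet> e) *\<^sub>R e = (x - (x \<bullet> e) *\<^sub>R e) + c *\<^sub>R e"
        by (simp add: scaleR_diff_left)
      also have "x - (x \<bullet> e) *\<^sub>R e = w"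
        using x by (simp add: diff_eq_eq)
      finally show ?thesis .
    qed
    have "x + (\<alpha> - x \<bullet> e) *\<^sub>R e \<in> K \<and> x + (\<beta> - x \<bullet> e) *\<^sub>R e \<in> K
        \<and> t = ((\<alpha> - x \<bullet> e) - (\<beta> - x \<bullet> e)) / 2 - x \<bullet> e"
    proof (intro conjI)
      show "t = ((\<alpha> - x \<bullet> e) - (\<beta> - x \<bullet> e)) / 2 - x \<bullet> e"
        using t by (simp add: field_simps)
    qed (use pq p q line in auto)
    then show "\<exists>a b. x + a *\<^sub>R e \<in> K \<and> x + b *\<^sub>R e \<in> K \<and> t = (a - b) / 2 - x \<bullet> e"
      by blast
  next
    assume "\<exists>a b. x + a *\<^sub>R e \<in> K \<and> x + b *\<^sub>R e \<in> K \<and> t = (a - b) / 2 - x \<bullet> e"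
    then obtain a b where ab: "x + a *\<^sub>R e \<in> K" "x + b *\<^sub>R e \<in> K" "t = (a - b) / 2 - x \<bullet> e"
      by blast
    have "(x + a *\<^sub>R e) + reflect e (x + b *\<^sub>R e) = 2 *\<^sub>R x + (a - b - 2 * (x \<bullet> e)) *\<^sub>R e"
      unfolding R by (simp add: algebra_simps scaleR_2)
    then have "x + t *\<^sub>R e = (1/2) *\<^sub>R ((x + a *\<^sub>R e) + reflect e (x + b *\<^sub>R e))"
      using ab(3) by (simp add: scaleR_add_right diff_divide_distrib)
    moreover have "(x + a *\<^sub>R e) + reflect e (x + a *\<^sub>R e) = (x + b *\<^sub>R e) + reflect e (x + b *\<^sub>R e)"
      unfolding R by (simp add: algebra_simps)
    ultimately show "x + t *\<^sub>R e \<in> steiner e K"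
      using ab(1,2) steinerI by metis
  qed
qed

text \<open>Convexity makes each I an interval, and (I - I)/2 has the same length as I; the chord
  formula turns equal chord lengths into equal volumes.\<close>

lemma vol_steiner:
  fixes K :: "'a::euclidean_space set"
  assumes K: "compact K" "convex K" and e: "norm e = 1"
  shows "vol (steiner e K) = vol K"
proof -
  have len: "emeasure lborel {t. x + t *\<^sub>R e \<in> steiner e K} = emeasure lborel {t. x + t *\<^sub>R e \<in> K}" for x
  proof -
    let ?I = "{t. x + t *\<^sub>R e \<in> K}"
    have "e \<noteq> 0"
      using e by auto
    have "?I = (\<lambda>t. x + t *\<^sub>R e) -` K"
      by auto
    have "compact ?I"
    proof -
      have "closed ?I"
        unfolding \<open>?I = _\<close> using K
        by (intro continuous_closed_vimage compact_imp_closed) (auto intro!: continuous_intros)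
      moreover have "bounded ?I"
      proof -
        obtain B where B: "\<And>y. y \<in> K \<Longrightarrow> norm y \<le> B"
          using compact_imp_bounded[OF K(1)] unfolding bounded_iff by auto
        have "norm t \<le> B + norm x" if "t \<in> ?I" for t
        proof -
          have "norm t = norm ((x + t *\<^sub>R e) - x)"
            using e by simp
          also have "\<dots> \<le> norm (x + t *\<^sub>R e) + norm x"
            by (rule norm_triangle_ineq4)
          finally show ?thesis
            using B that by fastforce
        qed
        then show ?thesis
          unfolding bounded_iff by blast
      qed
      ultimately show ?thesis
        by (simp add: compact_eq_bounded_closed)
    qed
    moreover have "convex ?I"
    proof (rule convexI)
      fix s t u v :: real
      assume st: "s \<in> ?I" "t \<in> ?I" and uv: "0 \<le> u" "0 \<le> v" "u + v = 1"
      have "x + (u *\<^sub>R s + v *\<^sub>R t) *\<^sub>R e = u *\<^sub>R (x + s *\<^sub>R e) + v *\<^sub>R (x + t *\<^sub>R e)"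
        using uv(3) by (simp add: algebra_simps flip: scaleR_add_left)
      then show "u *\<^sub>R s + v *\<^sub>R t \<in> ?I"
        using st uv K(2) by (auto intro: convexD)
    qed
    ultimately obtain l r where lr: "?I = {l..r}"
      using connected_compact_interval_1 convex_connected by meson
    have "{t. x + t *\<^sub>R e \<in> steiner e K} = {t. \<exists>a\<in>?I. \<exists>b\<in>?I. t = (a - b) / 2 - x \<bullet> e}"
      unfolding steiner_chord[OF e] by auto
    also have "\<dots> = (if l \<le> r then {(l - r) / 2 - x \<bullet> e .. (r - l) / 2 - x \<bullet> e} else {})"
    proof -
      have "\<exists>a\<in>{l..r}. \<exists>b\<in>{l..r}. t = (a - b) / 2 - x \<bullet> e"
        if "l \<le> r" "(l - r) / 2 - x \<bullet> e \<le> t" "t \<le> (r - l) / 2 - x \<bullet> e" for t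
        using that
        \<comment> \<open>The witnesses lie symmetrically about the midpoint of [l, r], at distance
          |t + x \<bullet> e|, so half their difference is t + x \<bullet> e.\<close>
        by (intro bexI[of _ "(l + r) / 2 + (t + x \<bullet> e)"] bexI[of _ "(l + r) / 2 - (t + x \<bullet> e)"])
          (auto simp: field_simps)
      then show ?thesis
        unfolding lr by auto
    qed
    finally show ?thesis
      unfolding lr by (auto simp: field_simps)
  qed
  have "emeasure lborel (steiner e K) = emeasure lborel K"
    using K e by (simp add: emeasure_eq_nn_integral_chords[where e = e] borel_compact compact_steiner len)
  then show ?thesis
    using K by (simp add: emeasure_lborel_compact compact_steiner)
qed

text \<open>Symmetrize along the vectors of \<open>F\<close> one after another; as they are pairwise
  orthogonal, no earlier symmetry is lost.\<close>

lemma exists_reflection_symmetric: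
  fixes K :: "'a::euclidean_space set"
  assumes F: "finite F" "F \<subseteq> Basis" and K: "compact K" "convex K"
  obtains K' :: "'a set" where "compact K'" "convex K'" "vol K' = vol K" "vol (mdiff K' K') \<le> vol (mdiff K K)"
    "\<And>e x. e \<in> F \<Longrightarrow> x \<in> K' \<Longrightarrow> reflect e x \<in> K'"
proof -
  have "\<exists>K' :: 'a set. compact K' \<and> convex K' \<and> vol K' = vol K \<and> vol (mdiff K' K') \<le> vol (mdiff K K)
      \<and> (\<forall>e\<in>F. \<forall>x\<in>K'. reflect e x \<in> K')"
    using F
  proof (induction F rule: finite_induct)
    case empty
    show ?case
    proof (intro exI[of _ K])
    qed (use K in auto)
  next
    case (insert e F)
    then obtain K' where K': "compact K'" "convex K'" "vol K' = vol K"
      "vol (mdiff K' K') \<le> vol (mdiff K K)" "\<forall>f\<in>F. \<forall>x\<in>K'. reflect f x \<in> K'"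
      by auto
    have e: "norm e = 1"
      using insert.prems by simp
    have "vol (mdiff (steiner e K') (steiner e K')) \<le> vol (steiner e (mdiff K' K'))"
      using K' by (intro vol_mono_compact mdiff_steiner_subset compact_mdiff compact_steiner)
    also have "\<dots> = vol (mdiff K' K')"
      using K' e by (intro vol_steiner compact_mdiff convex_mdiff)
    finally have "vol (mdiff (steiner e K') (steiner e K')) \<le> vol (mdiff K K)"
      using K'(4) by simp
    moreover have "reflect f x \<in> steiner e K'" if "f \<in> insert e F" "x \<in> steiner e K'" for f x
    proof (cases "f = e")
      case True
      then show ?thesis
        using reflect_mem_steiner[OF e] that by simp
    next
      case False
      then have "e \<bullet> f = 0"
        using that insert.prems by (intro inner_not_same_Basis) auto
      then show ?thesis
        using False that K'(5) by (intro reflect_mem_steiner_orthogonal) auto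
    qed
    ultimately show ?case
      using K' e by (intro exI[of _ "steiner e K'"]) (auto simp: compact_steiner convex_steiner vol_steiner)
  qed
  then show ?thesis
    using that by blast
qed

text \<open>The product of all coordinate reflections is -id. The induction flips the signs of the
  coordinates in \<open>F\<close> one at a time.\<close>

lemma uminus_mem_of_reflections:
  fixes K :: "'a::euclidean_space set"
  assumes "\<And>e x. e \<in> Basis \<Longrightarrow> x \<in> K \<Longrightarrow> reflect e x \<in> K" and x: "x \<in> K"
  shows "- x \<in> K"
proof -
  have "x - (\<Sum>b\<in>F. (2 * (x \<bullet> b)) *\<^sub>R b) \<in> K" if "finite F" "F \<subseteq> Basis" for F
    using that
  proof (induction F rule: finite_induct)
    case empty
    then show ?case
      using x by simp
  next
    case (insert e F)
    let ?y = "x - (\<Sum>b\<in>F. (2 * (x \<bullet> b)) *\<^sub>R b)"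
    \<comment> \<open>The flips made so far leave the coordinate along e untouched, so reflecting
      \<open>?y\<close> still subtracts 2 (x \<bullet> e) e.\<close>
    have "(\<Sum>b\<in>F. (2 * (x \<bullet> b)) *\<^sub>R b) \<bullet> e = 0"
      unfolding inner_sum_left
    proof (intro sum.neutral ballI)
      fix b assume "b \<in> F"
      then have "b \<bullet> e = 0"
        using insert.hyps insert.prems by (intro inner_not_same_Basis) auto
      then show "((2 * (x \<bullet> b)) *\<^sub>R b) \<bullet> e = 0"
        by simp
    qed
    then have "reflect e ?y = x - (\<Sum>b\<in>insert e F. (2 * (x \<bullet> b)) *\<^sub>R b)"
      using insert.hyps by (simp add: reflect_def inner_diff_left algebra_simps)
    then show ?case
      using assms(1)[of e ?y] insert by auto
  qed
  from this[of Basis] have "x - 2 *\<^sub>R (\<Sum>b\<in>Basis. (x \<bullet> b) *\<^sub>R b) \<in> K"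
    by (simp add: scaleR_sum_right)
  then show ?thesis
    by (simp add: euclidean_representation scaleR_2)
qed

text \<open>Steiner symmetrization does not increase the volume of \<open>K - K\<close>, and symmetrizing along a basis leads to a set with
  \<open>K = - K\<close>, where \<open>2 K \<subseteq> K - K\<close>.\<close>

theorem vol_difference_body_ge:
  fixes K :: "'a::euclidean_space set"
  assumes "compact K" "convex K"
  shows "2 ^ DIM('a) * vol K \<le> vol (mdiff K K)"
proof -
  obtain K' :: "'a set" where K': "compact K'" "vol K' = vol K" "vol (mdiff K' K') \<le> vol (mdiff K K)"
    and r: "\<And>e x. e \<in> Basis \<Longrightarrow> x \<in> K' \<Longrightarrow> reflect e x \<in> K'"
    using exists_reflection_symmetric[OF finite_Basis subset_refl assms] by metis
  have "(\<lambda>x. 2 *\<^sub>R x) ` K' \<subseteq> mdiff K' K'"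
  proof
    fix z assume "z \<in> (\<lambda>x. 2 *\<^sub>R x) ` K'"
    then obtain x where "x \<in> K'" "z = x - (- x)"
      by (auto simp: scaleR_2)
    then show "z \<in> mdiff K' K'"
      using uminus_mem_of_reflections[OF r] unfolding mdiff_def by blast
  qed
  then have "vol ((\<lambda>x. 2 *\<^sub>R x) ` K') \<le> vol (mdiff K' K')"
    using K' by (intro vol_mono_compact compact_mdiff compact_scaling)
  then show ?thesis
    using K' vol_scale[of 2 K'] by simp
qed

section \<open>Comparison of |A + B| with |A - B|\<close>

lemma vol_msum_le_vol_mdiff:
  fixes A B :: "'a::euclidean_space set"
  assumes A: "compact A" "convex A" and B: "compact B" "convex B" and pos: "vol (mdiff A B) > 0"
  shows "vol (msum A B) \<le> real (2 * DIM('a) choose DIM('a)) / 2 ^ DIM('a) * vol (mdiff A B)"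
proof -
  \<comment> \<open>Both sides are rearrangements of A + B + (-A) + (-B).\<close>
  have "mdiff (mdiff A B) (mdiff A B) = mdiff (msum A B) (msum A B)"
    by (simp add: mdiff_eq_msum_uminus uminus_image_msum) (metis msum_assoc msum_commute)
  moreover have "2 ^ DIM('a) * vol (msum A B) \<le> vol (mdiff (msum A B) (msum A B))"
    using A B by (intro vol_difference_body_ge compact_msum convex_msum)
  moreover have "vol (mdiff (mdiff A B) (mdiff A B)) \<le> real (2 * DIM('a) choose DIM('a)) * vol (mdiff A B)"
    using A B pos by (intro rogers_shephard compact_mdiff convex_mdiff)
  ultimately show ?thesis
    by (simp add: field_simps)
qed

subsection \<open>Finiteness of the sumset constant\<close>

text \<open>Repeats the condition inside \<open>c_const\<close> as an abbreviation, so that it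
  matches once \<open>c_const_def\<close> is unfolded.\<close>

abbreviation admissible_const :: "'a::euclidean_space itself \<Rightarrow> real \<Rightarrow> bool" where
  "admissible_const _ c \<equiv> c > 0 \<and> (\<forall>A B C :: 'a set.
      compact A \<and> convex A \<and> compact B \<and> convex B \<and> compact C \<and> convex C \<longrightarrow>
      vol A * vol (msum (msum A B) C) \<le> c * vol (msum A B) * vol (msum A C))"

text \<open>Two applications of Ruzsa's inequality reduce \<open>A + B + C\<close> to \<open>A - A - A\<close>, up to translation a subset of
  \<open>2 (A - A)\<close>.\<close>

lemma admissible_const_exists:
  "admissible_const TYPE('a::euclidean_space) (2 ^ DIM('a) * real (2 * DIM('a) choose DIM('a)))"
proof (intro conjI allI impI)
  show "0 < (2::real) ^ DIM('a) * real (2 * DIM('a) choose DIM('a))"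
    by simp
next
  fix A B C :: "'a set"
  assume ABC: "compact A \<and> convex A \<and> compact B \<and> convex B \<and> compact C \<and> convex C"
  then have c: "compact A" "convex A" "compact B" "compact C"
    by auto
  let ?c = "2 ^ DIM('a) * real (2 * DIM('a) choose DIM('a))"
  show "vol A * vol (msum (msum A B) C) \<le> ?c * vol (msum A B) * vol (msum A C)"
  proof (cases "vol A = 0")
    case True
    then show ?thesis
      by simp
  next
    case False
    then have pos: "vol A > 0"
      by (metis less_eq_real_def measure_nonneg)
    let ?D = "mdiff A A"
    have "A \<noteq> {}"
      using pos by auto
    then obtain a where a: "a \<in> A"
      by auto
    have triple: "vol (mdiff ?D A) \<le> ?c * vol A"
    proof -
      have "mdiff ?D A \<subseteq> (+) (- a) ` ((\<lambda>x. 2 *\<^sub>R x) ` ?D)"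
      proof
        fix z assume "z \<in> mdiff ?D A"
        then obtain p q r where z: "p \<in> A" "q \<in> A" "r \<in> A" "z = p - q - r"
          unfolding mdiff_def by blast
        \<comment> \<open>Halving z + a = (p + a) - (q + r) produces midpoints of points of A, which
          lie in A by convexity.\<close>
        let ?w = "((1/2) *\<^sub>R p + (1/2) *\<^sub>R a) - ((1/2) *\<^sub>R q + (1/2) *\<^sub>R r)"
        have "(1/2) *\<^sub>R p + (1/2) *\<^sub>R a \<in> A" "(1/2) *\<^sub>R q + (1/2) *\<^sub>R r \<in> A"
          using a z c(2) by (auto intro: convexD)
        then have "?w \<in> ?D"
          unfolding mdiff_def by blast
        moreover have "z = - a + 2 *\<^sub>R ?w"
          unfolding z by (simp add: algebra_simps)
        ultimately show "z \<in> (+) (- a) ` ((\<lambda>x. 2 *\<^sub>R x) ` ?D)"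
          by blast
      qed
      then have "vol (mdiff ?D A) \<le> vol ((+) (- a) ` ((\<lambda>x. 2 *\<^sub>R x) ` ?D))"
        using c by (intro vol_mono_compact compact_mdiff compact_translation compact_scaling)
      also have "\<dots> = 2 ^ DIM('a) * vol ?D"
        unfolding vol_translate using vol_scale[of 2 ?D] by simp
      also have "\<dots> \<le> 2 ^ DIM('a) * (real (2 * DIM('a) choose DIM('a)) * vol A)"
        using rogers_shephard[OF c(1,2) pos] by (intro mult_left_mono) auto
      finally show ?thesis
        by simp
    qed
    \<comment> \<open>First use of Ruzsa, with S = C and T = A - A, after regrouping (A + C) - A as
      C + (A - A).\<close>
    have "vol A * vol (mdiff (msum A C) A) = vol A * vol (msum C ?D)"
      by (simp add: mdiff_eq_msum_uminus) (metis msum_assoc msum_commute)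
    also have "\<dots> \<le> vol (msum A C) * vol (mdiff ?D A)"
      using c by (intro vol_ruzsa_triangle compact_mdiff)
    also have "\<dots> \<le> vol (msum A C) * (?c * vol A)"
      using triple by (intro mult_left_mono) auto
    finally have "vol A * vol (mdiff (msum A C) A) \<le> vol A * (?c * vol (msum A C))"
      by (simp add: mult_ac)
    then have AC: "vol (mdiff (msum A C) A) \<le> ?c * vol (msum A C)"
      using pos by simp
    \<comment> \<open>Second use, with S = B and T = A + C.\<close>
    have "vol A * vol (msum (msum A B) C) = vol A * vol (msum B (msum A C))"
      by (metis msum_assoc msum_commute)
    also have "\<dots> \<le> vol (msum A B) * vol (mdiff (msum A C) A)"
      using c by (intro vol_ruzsa_triangle compact_msum)
    also have "\<dots> \<le> vol (msum A B) * (?c * vol (msum A C))"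
      using AC by (intro mult_left_mono) auto
    finally show ?thesis
      by (simp add: mult_ac)
  qed
qed

text \<open>Nonemptiness from \<open>admissible_const_exists\<close> matters here: the
  \<open>Inf\<close> of an empty set of reals carries no information.\<close>

lemma c_const_nonneg: "0 \<le> c_const TYPE('a::euclidean_space)"
  unfolding c_const_def by (rule cInf_greatest) (use admissible_const_exists[where 'a = 'a] in blast, auto)

text \<open>The infimum itself satisfies the inequality, because the quotient of the two sides is a
  lower bound for all admissible constants.\<close>

lemma c_const_bound:
  fixes A B C :: "'a::euclidean_space set"
  assumes "compact A" "convex A" "compact B" "convex B" "compact C" "convex C"
  shows "vol A * vol (msum (msum A B) C) \<le> c_const TYPE('a) * (vol (msum A B) * vol (msum A C))"
    (is "?L \<le> _ * ?R")
proof -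
  have L: "?L \<le> c * ?R" if "admissible_const TYPE('a) c" for c
    using that assms by (simp add: mult.assoc)
  show ?thesis
  \<comment> \<open>With \<open>?R = 0\<close> no quotient can be formed; any admissible constant
    then already forces \<open>?L\<close> \<le> 0.\<close>
  proof (cases "?R = 0")
    case True
    then show ?thesis
      using L[OF admissible_const_exists] unfolding True by simp
  next
    case False
    then have "?R > 0"
      by (metis less_eq_real_def measure_nonneg mult_nonneg_nonneg)
    then have "?L / ?R \<le> c" if "admissible_const TYPE('a) c" for c
      using L[OF that] by (simp add: field_simps)
    then have "?L / ?R \<le> c_const TYPE('a)"
      unfolding c_const_def by (intro cInf_greatest) (use admissible_const_exists[where 'a = 'a] in blast, auto)
    then show ?thesis
      using \<open>?R > 0\<close> by (simp add: field_simps)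
  qed
qed

lemma vol_convex_body_pos:
  fixes K :: "'a::euclidean_space set"
  assumes "convex_body K"
  shows "vol K > 0"
proof -
  have K: "K \<in> lmeasurable" "interior K \<noteq> {}"
    using assms by (auto simp: convex_body_def lmeasurable_compact)
  have "\<not> negligible K"
    using K(2) by (meson open_interior interior_subset negligible_subset open_not_negligible)
  then show ?thesis
    using K(1) by (metis less_eq_real_def measure_nonneg negligible_iff_measure)
qed

section \<open>The two bounds and their minimum\<close>

theorem theorem5p2:
  fixes A B C :: "'a::euclidean_space set"
  assumes "convex_body A" and "convex_body B" and "convex_body C"
  shows "vol A * vol (msum (msum A B) C)
    \<le> real (DIM('a) * 2 choose DIM('a)) / 2 ^ DIM('a) * c_const TYPE('a)
       * min (vol (mdiff A B) * vol (msum A C)) (vol (mdiff A B) * vol (mdiff A C))"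
proof -
  let ?b = "real (2 * DIM('a) choose DIM('a)) / 2 ^ DIM('a)" and ?c = "c_const TYPE('a)"
  have A: "compact A" "convex A" and B: "compact B" "convex B" and C: "compact C" "convex C"
    using assms by (auto simp: convex_body_def)
  let ?A = "uminus ` A"
  have A': "compact ?A" "convex ?A"
    using A by (simp_all add: compact_uminus_image convex_uminus_image)
  have ne: "A \<noteq> {}" "B \<noteq> {}" "C \<noteq> {}" and posA: "vol A > 0"
    using assms vol_convex_body_pos by (auto simp: convex_body_def)
  \<comment> \<open>A - S contains a translate of A. This supplies the positivity assumed in
    \<open>vol_msum_le_vol_mdiff\<close>.\<close>
  have pos: "vol (mdiff A S) > 0" if "compact S" "S \<noteq> {}" for S
    using posA vol_le_vol_msum[of A "uminus ` S"] A that
    by (simp add: mdiff_eq_msum_uminus compact_uminus_image)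
  \<comment> \<open>-A + S is the reflection of A - S, so bounds for -A, B, C read as bounds in A -
    B and A - C.\<close>
  have swap: "vol (msum ?A S) = vol (mdiff A S)" for S
    using vol_uminus[of "mdiff A S"]
    by (simp add: mdiff_eq_msum_uminus uminus_image_msum del: vol_uminus)

  have "vol A * vol (msum (msum A B) C) \<le> ?c * (vol (msum A B) * vol (msum A C))"
    by (intro c_const_bound A B C)
  also have "\<dots> \<le> ?c * ((?b * vol (mdiff A B)) * vol (msum A C))"
    using A B pos ne
    by (intro mult_left_mono mult_right_mono vol_msum_le_vol_mdiff c_const_nonneg) auto
  finally have 1: "vol A * vol (msum (msum A B) C) \<le> ?b * ?c * (vol (mdiff A B) * vol (msum A C))"
    by (simp add: mult_ac)

  have BC: "compact (msum B C)" "convex (msum B C)" "msum B C \<noteq> {}"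
    using B C ne by (auto intro: compact_msum convex_msum) (auto simp: msum_def)
  \<comment> \<open>The comparison is applied to A and B + C; reflecting A - (B + C) then gives the
    triple sum -A + B + C.\<close>
  have "vol (msum (msum A B) C) \<le> ?b * vol (mdiff A (msum B C))"
    unfolding msum_assoc using A BC pos by (intro vol_msum_le_vol_mdiff)
  also have "vol (mdiff A (msum B C)) = vol (msum (msum ?A B) C)"
    by (simp add: msum_assoc swap)
  finally have "vol A * vol (msum (msum A B) C) \<le> vol A * (?b * vol (msum (msum ?A B) C))"
    by (intro mult_left_mono) auto
  also have "\<dots> = ?b * (vol ?A * vol (msum (msum ?A B) C))"
    by simp
  also have "\<dots> \<le> ?b * (?c * (vol (msum ?A B) * vol (msum ?A C)))"
    by (intro mult_left_mono c_const_bound A' B C) simp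
  finally have 2: "vol A * vol (msum (msum A B) C) \<le> ?b * ?c * (vol (mdiff A B) * vol (mdiff A C))"
    by (simp add: swap mult_ac)

  show ?thesis
    using 1 2 by (simp add: min_def mult.commute[of _ 2])
qed

end
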